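(* Let $Y$ be a real Banach space and let $X$ be a subspace of $Y$ which is a strict ideal in $Y$. Then $X$ is an almost isometric ideal in $Y$.
   Context: All Banach spaces are real. Let $X$ be a subspace of a Banach space $Y$. A linear operator $\varphi:X^{*}\to Y^{*}$ is a Hahn-Banach extension operator if $\varphi(x^{*})(x)=x^{*}(x)$ and $\|\varphi(x^{*})\|=\|x^{*}\|$ for all $x\in X$ and $x^{*}\in X^{*}$. $X$ is an ideal in $Y$ if such an operator exists (equivalently, if the annihilator $X^{\perp}\subset Y^{*}$ is the kernel of a norm one projection $P$ on $Y^{*}$; $\varphi$ and $P$ are related by $P(Y^{*})=\varphi(X^{*})$). $X$ is a strict ideal in $Y$ if there is a Hahn-Banach extension operator $\varphi:X^{*}\to Y^{*}$ whose range is 1-norming for $Y$, i.e. $\|y\|=\sup\{|y^{*}(y)| : y^{*}\in\varphi(X^{*}),\ \|y^{*}\|\le 1\}$ for all $y\in Y$. $X$ is an almost isometric ideal (ai-ideal) in $Y$ if for every $\varepsilon>0$ and every finite-dimensional subspace $E\subset Y$ there exists a linear operator $T:E\to X$ such that $Te=e$ for all $e\in X\cap E$ and $(1+\varepsilon)^{-1}\|e\|\le\|Te\|\le(1+\varepsilon)\|e\|$ for all $e\in E$. *)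

theory Defs
  imports "HOL-Analysis.Analysis"
begin

definition linear_on :: "'a::real_vector set \<Rightarrow> ('a \<Rightarrow> 'b::real_vector) \<Rightarrow> bool" where
  "linear_on V f \<longleftrightarrow>
     (\<forall>x\<in>V. \<forall>y\<in>V. f (x + y) = f x + f y) \<and> (\<forall>c. \<forall>x\<in>V. f (c *\<^sub>R x) = c *\<^sub>R f x)"

text \<open>The dual of a linear subspace \<open>X\<close>. The functionals are extended by the junk value 0 outside
  \<open>X\<close>, so that each functional on \<open>X\<close> is represented by exactly one HOL function and pointwise
  sums and scalar multiples stay in the carrier. The extension carries no meaning; in
  particular it is not linear on the ambient space unless the functional is 0 or \<open>X\<close> is the
  whole space.\<close>

definition dual_space :: "'a::real_normed_vector set \<Rightarrow> ('a \<Rightarrow> real) set" where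
  "dual_space X =
     {f. linear_on X f \<and> (\<exists>K. \<forall>x\<in>X. \<bar>f x\<bar> \<le> K * norm x) \<and> (\<forall>x. x \<notin> X \<longrightarrow> f x = 0)}"

definition dual_norm :: "'a::real_normed_vector set \<Rightarrow> ('a \<Rightarrow> real) \<Rightarrow> real" where
  "dual_norm X f = Sup {\<bar>f x\<bar> | x. x \<in> X \<and> norm x \<le> 1}"

text \<open>The dual of the ambient space is the library's type of bounded linear functionals, with its
  operator norm. Linearity is spelled out because \<open>dual_space X\<close> is a set of functions
  rather than a type of class \<open>real_vector\<close>.\<close>

definition hahn_banach_extension_operator ::
    "'a::real_normed_vector set \<Rightarrow> (('a \<Rightarrow> real) \<Rightarrow> ('a \<Rightarrow>\<^sub>L real)) \<Rightarrow> bool" where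
  "hahn_banach_extension_operator X \<phi> \<longleftrightarrow>
     (\<forall>f\<in>dual_space X. \<forall>g\<in>dual_space X. \<phi> (\<lambda>x. f x + g x) = \<phi> f + \<phi> g) \<and>
     (\<forall>c. \<forall>f\<in>dual_space X. \<phi> (\<lambda>x. c * f x) = c *\<^sub>R \<phi> f) \<and>
     (\<forall>f\<in>dual_space X. \<forall>x\<in>X. blinfun_apply (\<phi> f) x = f x) \<and>
     (\<forall>f\<in>dual_space X. norm (\<phi> f) = dual_norm X f)"

definition one_norming :: "('a::real_normed_vector \<Rightarrow>\<^sub>L real) set \<Rightarrow> bool" where
  "one_norming N \<longleftrightarrow>
     (\<forall>y. norm y = Sup {\<bar>blinfun_apply g y\<bar> | g. g \<in> N \<and> norm g \<le> 1})"

definition strict_ideal :: "'a::real_normed_vector set \<Rightarrow> bool" where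
  "strict_ideal X \<longleftrightarrow>
     (\<exists>\<phi>. hahn_banach_extension_operator X \<phi> \<and> one_norming (\<phi> ` dual_space X))"

text \<open>\<open>T\<close> is a total HOL function of which only the restriction to \<open>E\<close> matters.\<close>

definition ai_ideal :: "'a::real_normed_vector set \<Rightarrow> bool" where
  "ai_ideal X \<longleftrightarrow>
     (\<forall>\<epsilon>>0. \<forall>E. subspace E \<and> (\<exists>B. finite B \<and> E = span B) \<longrightarrow>
        (\<exists>T. linear_on E T \<and> T ` E \<subseteq> X \<and> (\<forall>e\<in>X \<inter> E. T e = e) \<and>
             (\<forall>e\<in>E. inverse (1 + \<epsilon>) * norm e \<le> norm (T e) \<and>
                    norm (T e) \<le> (1 + \<epsilon>) * norm e)))"

end

theory Submission
  imports Defs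
begin

text \<open>The theorem is a local reflexivity principle. Let \<open>\<phi>\<close> be a Hahn-Banach extension operator whose
  range is 1-norming. Then \<open>y \<mapsto> (f \<mapsto> \<phi> f y)\<close> maps the ambient space isometrically into the
  bidual of \<open>X\<close> and is the canonical embedding on \<open>X\<close>. What remains is to push a finite-dimensional
  subspace of the bidual back into \<open>X\<close>, almost isometrically and without moving the part
  that already lies in \<open>X\<close>. The proof never forms the bidual; all of it is expressed through \<open>\<phi>\<close>.

  Fix a finite-dimensional \<open>E\<close>, a finite \<open>\<delta>\<close>-net \<open>y\<^sub>i\<close> of its unit sphere and functionals \<open>f\<^sub>i\<close> on
  \<open>X\<close> with \<open>\<phi> f\<^sub>i\<close> in the unit ball and \<open>\<bar>\<phi> f\<^sub>i y\<^sub>i\<bar> > 1 - \<delta>\<close>. If a linear \<open>T : E \<rightarrow> X\<close> fixing \<open>X \<inter> E\<close> satisfies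
  \<open>norm (T y\<^sub>i) < 1 + \<delta>\<close> and \<open>f\<^sub>i (T y\<^sub>i) \<approx> \<phi> f\<^sub>i y\<^sub>i\<close>, then \<open>norm (T y\<^sub>i)\<close> is nearly 1 for all \<open>i\<close>, and an operator
  that is nearly isometric on a net of the sphere is nearly isometric on \<open>E\<close>
  (\<open>almost_isometric_on_net\<close>).

  Such a \<open>T\<close> exists by a separation argument (\<open>approximate_local_reflexivity\<close>). The tuples
  \<open>(T y\<^sub>i, M (\<phi> f\<^sub>i y\<^sub>i - f\<^sub>i (T y\<^sub>i)))\<^sub>i\<close> form a convex set. If no \<open>T\<close> worked, this set
  would stay outside the ball of radius \<open>1 + \<delta>\<close> for the maximum norm, hence by Hahn-Banach a functional
  of norm at most 1 would be at least \<open>1 + \<delta>\<close> on it. Written out, this functional is a finite sum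
  \<open>\<Sum>\<^sub>i h\<^sub>i (T y\<^sub>i)\<close> plus a constant, with \<open>h\<^sub>i\<close> in the dual of \<open>X\<close>. But some \<open>T\<close> satisfies
  \<open>\<Sum>\<^sub>i h\<^sub>i (T y\<^sub>i) = \<Sum>\<^sub>i \<phi> h\<^sub>i y\<^sub>i\<close> (\<open>local_projection_matching_extension\<close>), and for this \<open>T\<close> the value of
  the functional is what it would be at the tuple \<open>(y\<^sub>i, 0)\<^sub>i\<close>, which is at most 1 because \<open>\<phi>\<close> preserves
  norms.

  The Hahn-Banach theorem for normed spaces and the compactness of finite-dimensional spheres are
  proved along the way.\<close>

section \<open>Separation from a ball in a normed space\<close>

definition sublinear :: "('v::real_vector \<Rightarrow> real) \<Rightarrow> bool" where
  "sublinear p \<longleftrightarrow>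
     (\<forall>x y. p (x + y) \<le> p x + p y) \<and> (\<forall>t x. 0 \<le> t \<longrightarrow> p (t *\<^sub>R x) = t * p x)"

text \<open>For positive \<open>t\<close> the inequality at \<open>inverse t\<close> gives the reverse inequality at \<open>t\<close>; at the zero
  vector the cases \<open>t = 2\<close> and \<open>t = 1 / 2\<close> leave only the value 0.\<close>

lemma sublinearI:
  assumes add: "\<And>x y. p (x + y) \<le> p x + p y"
    and scale: "\<And>t x. 0 < t \<Longrightarrow> p (t *\<^sub>R x) \<le> t * p x"
  shows "sublinear p"
proof -
  have "p 0 = 0"
    using scale[of 2 0] scale[of "1 / 2" 0] by simp
  moreover have "p (t *\<^sub>R x) = t * p x" if "0 < t" for t x
    using scale[of "inverse t" "t *\<^sub>R x"] scale[of t x] that by (simp add: field_simps)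
  ultimately have "p (t *\<^sub>R x) = t * p x" if "0 \<le> t" for t x
    using that by (cases "t = 0") auto
  with add show ?thesis by (simp add: sublinear_def)
qed

lemma sublinear_ge:
  assumes "sublinear p"
  shows "- p (- x) \<le> p x"
proof -
  have "p (x + (- x)) \<le> p x + p (- x)" "p (0 *\<^sub>R x) = 0 * p x"
    using assms unfolding sublinear_def by blast+
  then show ?thesis by simp
qed

text \<open>Every new sublinear functional below arises as a pointwise infimum: over a chain, over the shifts
  along one vector, or over a convex cone. The two hypotheses on \<open>K\<close> are what the three cases share:
  two indices can be combined into one, and an index can be rescaled.\<close>

lemma sublinear_INF:
  fixes q :: "'k \<Rightarrow> 'v::real_vector \<Rightarrow> real"
  assumes ne: "K \<noteq> {}"
    and bdd: "\<And>x. bdd_below ((\<lambda>k. q k x) ` K)"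
    and add: "\<And>k l x y. k \<in> K \<Longrightarrow> l \<in> K \<Longrightarrow> \<exists>m\<in>K. q m (x + y) \<le> q k x + q l y"
    and scale: "\<And>k t x. k \<in> K \<Longrightarrow> 0 < t \<Longrightarrow> \<exists>m\<in>K. q m (t *\<^sub>R x) \<le> t * q k x"
  shows "sublinear (\<lambda>x. INF k\<in>K. q k x)"
proof (rule sublinearI)
  let ?p = "\<lambda>x. INF k\<in>K. q k x"
  have le: "?p z \<le> r" if "m \<in> K" "q m z \<le> r" for z m r
    using cINF_lower2[OF bdd that] .
  show "?p (x + y) \<le> ?p x + ?p y" for x y
  proof -
    have "?p (x + y) - q k x \<le> ?p y" if k: "k \<in> K" for k
    proof (rule cINF_greatest[OF ne])
      fix l assume "l \<in> K"
      then obtain m where "m \<in> K" "q m (x + y) \<le> q k x + q l y" using add k by blast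
      from le[OF this] show "?p (x + y) - q k x \<le> q l y" by simp
    qed
    then have "?p (x + y) - ?p y \<le> ?p x"
      by (intro cINF_greatest[OF ne]) (simp add: algebra_simps)
    then show ?thesis by simp
  qed
  show "?p (t *\<^sub>R x) \<le> t * ?p x" if t: "0 < t" for t x
  proof -
    have "?p (t *\<^sub>R x) / t \<le> ?p x"
    proof (rule cINF_greatest[OF ne])
      fix k assume "k \<in> K"
      then obtain m where "m \<in> K" "q m (t *\<^sub>R x) \<le> t * q k x" using scale t by blast
      from le[OF this] show "?p (t *\<^sub>R x) / t \<le> q k x" using t by (simp add: field_simps)
    qed
    then show ?thesis using t by (simp add: field_simps)
  qed
qed

text \<open>The infimum over \<open>t \<ge> 0\<close> of \<open>p (x + t v) - t p v\<close> is sublinear and at most \<open>p\<close>, so by minimality it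
  equals \<open>p\<close>; its term at \<open>t = 1\<close> then says that \<open>p x + p v \<le> p (x + v)\<close>.\<close>

lemma minimal_sublinear_linear:
  assumes p: "sublinear p"
    and minimal: "\<And>q. sublinear q \<Longrightarrow> q \<le> p \<Longrightarrow> q = p"
  shows "linear p"
proof -
  have sub: "p (x + y) \<le> p x + p y" for x y using p by (simp add: sublinear_def)
  have hom: "p (t *\<^sub>R x) = t * p x" if "0 \<le> t" for t x using p that by (simp add: sublinear_def)
  have add: "p (x + v) = p x + p v" for x v
  proof -
    define q where "q t x = p (x + t *\<^sub>R v) - t * p v" for t x
    have low: "- p (- x) \<le> q t x" if "0 \<le> t" for t x
      using sub[of "x + t *\<^sub>R v" "- x"] hom[OF that, of v] by (simp add: q_def)
    then have bdd: "bdd_below ((\<lambda>t. q t x) ` {0..})" for x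
      by (auto simp: bdd_below_def)
    have "sublinear (\<lambda>x. INF t\<in>{0..}. q t x)"
    proof (rule sublinear_INF[OF _ bdd])
      fix s t :: real and x y assume "s \<in> {0..}" "t \<in> {0..}"
      then show "\<exists>m\<in>{0..}. q m (x + y) \<le> q s x + q t y"
        using sub[of "x + s *\<^sub>R v" "y + t *\<^sub>R v"]
        by (intro bexI[of _ "s + t"]) (auto simp: q_def algebra_simps)
    next
      fix s t :: real and x assume "s \<in> {0..}" "0 < t"
      then show "\<exists>m\<in>{0..}. q m (t *\<^sub>R x) \<le> t * q s x"
        using hom[of t "x + s *\<^sub>R v"]
        by (intro bexI[of _ "t * s"]) (auto simp: q_def algebra_simps)
    qed simp
    moreover have "(\<lambda>x. INF t\<in>{0..}. q t x) \<le> p"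
      by (rule le_funI, rule cINF_lower2[OF bdd, of 0]) (auto simp: q_def)
    ultimately have "(\<lambda>x. INF t\<in>{0..}. q t x) = p" by (rule minimal)
    then have "p x \<le> q 1 x" using cINF_lower[OF bdd[of x], of 1] by (auto dest: fun_cong[of _ _ x])
    then show ?thesis using sub[of x v] by (simp add: q_def)
  qed
  have "p (t *\<^sub>R x) = t * p x" for t x
  proof (cases "0 \<le> t")
    case False
    have "p (t *\<^sub>R x) + p ((- t) *\<^sub>R x) = p 0" using add[of "t *\<^sub>R x" "(- t) *\<^sub>R x"] by simp
    moreover have "p 0 = 0" using hom[of 0 x] by simp
    ultimately show ?thesis using hom[of "- t" x] False by simp
  qed (simp add: hom)
  with add show ?thesis by (intro linearI) auto
qed

text \<open>This is the Hahn-Banach theorem in the form in which no functional needs extending: Zorn's lemma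
  yields a minimal sublinear functional below \<open>p\<close>. Lower bounds of chains exist because a sublinear \<open>q \<le> p\<close>
  satisfies \<open>q x \<ge> - p (- x)\<close>.\<close>

lemma sublinear_dominates_linear:
  fixes p :: "'v::real_vector \<Rightarrow> real"
  assumes p: "sublinear p"
  obtains f where "linear f" "f \<le> p"
proof -
  define A where "A = {q. sublinear q \<and> q \<le> p}"
  have "\<exists>m\<in>A. \<forall>a\<in>A. m \<ge> a \<longrightarrow> a = m"
  proof (rule predicate_Zorn)
    show "partial_order_on A (relation_of (\<ge>) A)"
      by (auto simp: partial_order_on_def preorder_on_def refl_on_def trans_def antisym_def relation_of_def)
  next
    fix C assume C: "C \<in> Chains (relation_of (\<ge>) A)"
    then have CA: "C \<subseteq> A" and comp: "\<And>q r. q \<in> C \<Longrightarrow> r \<in> C \<Longrightarrow> q \<le> r \<or> r \<le> q"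
      by (auto simp: Chains_def relation_of_def)
    show "\<exists>u\<in>A. \<forall>a\<in>C. a \<ge> u"
    proof (cases "C = {}")
      case True
      then show ?thesis using p by (auto simp: A_def)
    next
      case False
      have sub: "sublinear q" "q x \<le> p x" if "q \<in> C" for q x
        using that CA by (auto simp: A_def le_fun_def)
      have "- p (- x) \<le> q x" if "q \<in> C" for q x
        using sublinear_ge[OF sub(1)[OF that], of x] sub(2)[OF that, of "- x"] by simp
      then have bdd: "bdd_below ((\<lambda>q. q x) ` C)" for x by (auto simp: bdd_below_def)
      have "sublinear (\<lambda>x. INF q\<in>C. q x)"
      proof (rule sublinear_INF[OF False bdd])
        fix q r x y assume qr: "q \<in> C" "r \<in> C"
        then obtain m where m: "m \<in> C" "m \<le> q" "m \<le> r" using comp by blast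
        have "m (x + y) \<le> m x + m y" using sub(1)[OF m(1)] by (simp add: sublinear_def)
        also have "\<dots> \<le> q x + r y" using m by (auto simp: le_fun_def intro: add_mono)
        finally show "\<exists>m\<in>C. m (x + y) \<le> q x + r y" using m by blast
      next
        fix q and t :: real and x assume "q \<in> C" "0 < t"
        then show "\<exists>m\<in>C. m (t *\<^sub>R x) \<le> t * q x"
          using sub(1)[of q] by (intro bexI[of _ q]) (auto simp: sublinear_def)
      qed
      moreover have lower: "(\<lambda>x. INF q\<in>C. q x) \<le> q" if "q \<in> C" for q
        by (rule le_funI, rule cINF_lower[OF bdd that])
      moreover obtain q where "q \<in> C" using False by blast
      with lower[OF this] sub(2)[OF this] have "(\<lambda>x. INF q\<in>C. q x) \<le> p"
        by (force simp: le_fun_def intro: order_trans)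
      ultimately show ?thesis using lower by (auto simp: A_def)
    qed
  qed
  then obtain f where f: "f \<in> A" "\<And>q. q \<in> A \<Longrightarrow> q \<le> f \<Longrightarrow> q = f" by blast
  have "linear f"
    using f by (intro minimal_sublinear_linear) (auto simp: A_def intro: order_trans)
  with f(1) show ?thesis by (intro that) (auto simp: A_def)
qed

text \<open>The functional is a linear minorant of the infimum of \<open>norm (v + s c) - \<alpha> s\<close> over \<open>s \<ge> 0\<close> and
  \<open>c \<in> C\<close>: the choice \<open>s = 0\<close> bounds it by the norm, and the choice \<open>v = - c\<close>, \<open>s = 1\<close> makes it at
  least \<open>\<alpha>\<close> at \<open>c\<close>. The infimum is finite because \<open>C\<close> lies outside the ball of radius \<open>\<alpha>\<close>.\<close>

lemma convex_outside_ball_separation: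
  fixes C :: "'v::real_normed_vector set"
  assumes C: "convex C" "C \<noteq> {}" and \<alpha>: "\<And>c. c \<in> C \<Longrightarrow> \<alpha> \<le> norm c"
  obtains f where "linear f" "\<And>v. f v \<le> norm v" "\<And>c. c \<in> C \<Longrightarrow> \<alpha> \<le> f c"
proof -
  define K where "K = {(s, s *\<^sub>R c) | s c. 0 \<le> s \<and> c \<in> C}"
  define q where "q k v = norm (v + snd k) - \<alpha> * fst k" for k :: "real \<times> 'v" and v
  (* K is the convex cone over C, each vector being paired with its scaling factor. *)
  have K0: "(0, 0) \<in> K" using C(2) by (force simp: K_def)
  have K_add: "k + l \<in> K" if kl: "k \<in> K" "l \<in> K" for k l
  proof -
    obtain s c where k: "k = (s, s *\<^sub>R c)" "0 \<le> s" "c \<in> C" using kl by (auto simp: K_def)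
    obtain t d where l: "l = (t, t *\<^sub>R d)" "0 \<le> t" "d \<in> C" using kl by (auto simp: K_def)
    show ?thesis
    proof (cases "s + t = 0")
      case True
      then show ?thesis using k l K0 by (simp add: add_nonneg_eq_0_iff zero_prod_def)
    next
      case False
      with k l have st: "0 < s + t" by simp
      have "(s / (s + t)) *\<^sub>R c + (t / (s + t)) *\<^sub>R d \<in> C"
        using k l st by (intro convexD[OF C(1)]) (auto simp flip: add_divide_distrib)
      moreover have "k + l = (s + t, (s + t) *\<^sub>R ((s / (s + t)) *\<^sub>R c + (t / (s + t)) *\<^sub>R d))"
        using st by (simp add: k l scaleR_add_right)
      ultimately show ?thesis unfolding K_def using st by fastforce
    qed
  qed
  have K_scale: "t *\<^sub>R k \<in> K" if "k \<in> K" "0 < t" for k t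
    using that by (force simp: K_def)
  have "- norm v \<le> q k v" if "k \<in> K" for k v
  proof -
    obtain s c where k: "k = (s, s *\<^sub>R c)" "0 \<le> s" "c \<in> C" using \<open>k \<in> K\<close> by (auto simp: K_def)
    have "s * \<alpha> \<le> s * norm c" using k \<alpha> by (intro mult_left_mono)
    moreover have "norm (s *\<^sub>R c) \<le> norm (v + s *\<^sub>R c) + norm v"
      using norm_triangle_ineq4[of "v + s *\<^sub>R c" v] by simp
    ultimately show ?thesis using k by (simp add: q_def mult.commute)
  qed
  then have bdd: "bdd_below ((\<lambda>k. q k v) ` K)" for v by (rule bdd_belowI2)
  have "sublinear (\<lambda>v. INF k\<in>K. q k v)"
  proof (rule sublinear_INF[OF _ bdd])
    show "K \<noteq> {}" using K0 by blast
  next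
    fix k l v w assume "k \<in> K" "l \<in> K"
    then show "\<exists>m\<in>K. q m (v + w) \<le> q k v + q l w"
      using K_add norm_triangle_ineq[of "v + snd k" "w + snd l"]
      by (intro bexI[of _ "k + l"]) (auto simp: q_def algebra_simps)
  next
    fix k t v assume "k \<in> K" "0 < (t::real)"
    moreover from this have "norm (t *\<^sub>R v + t *\<^sub>R snd k) = t * norm (v + snd k)"
      by (metis abs_of_pos norm_scaleR scaleR_add_right)
    ultimately show "\<exists>m\<in>K. q m (t *\<^sub>R v) \<le> t * q k v"
      using K_scale by (intro bexI[of _ "t *\<^sub>R k"]) (auto simp: q_def algebra_simps)
  qed
  then obtain f where f: "linear f" "f \<le> (\<lambda>v. INF k\<in>K. q k v)"
    by (rule sublinear_dominates_linear)
  have fq: "f v \<le> q k v" if "k \<in> K" for k v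
    using f(2) cINF_lower[OF bdd that, of v] by (auto simp: le_fun_def intro: order_trans)
  show ?thesis
  proof
    show "linear f" by fact
    show "f v \<le> norm v" for v using fq[OF K0, of v] by (simp add: q_def)
    show "\<alpha> \<le> f c" if "c \<in> C" for c
    proof -
      have "(1, c) \<in> K" using that by (force simp: K_def)
      from fq[OF this, of "- c"] show ?thesis using linear_neg[OF f(1), of c] by (simp add: q_def)
    qed
  qed
qed

text \<open>The separation theorem in the space of \<open>n\<close>-tuples with the maximum norm. A tuple is encoded as a
  bounded continuous function on the discrete space of natural numbers vanishing from \<open>n\<close> on: this
  is a normed space for every \<open>n\<close>, and its norm is the supremum norm. The functionals \<open>g i\<close> are the
  components of the separating functional.\<close>

lemma finite_family_separation:
  fixes C :: "(nat \<Rightarrow> 'z::real_normed_vector) set"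
  assumes C: "C \<noteq> {}"
    and convex: "\<And>c d s t. c \<in> C \<Longrightarrow> d \<in> C \<Longrightarrow> 0 \<le> s \<Longrightarrow> 0 \<le> t \<Longrightarrow> s + t = 1 \<Longrightarrow>
                   (\<lambda>i. s *\<^sub>R c i + t *\<^sub>R d i) \<in> C"
    and far: "\<And>c. c \<in> C \<Longrightarrow> \<exists>i<n. \<alpha> \<le> norm (c i)"
  obtains g :: "nat \<Rightarrow> 'z \<Rightarrow> real" where
    "\<And>i. bounded_linear (g i)"
    "\<And>z. \<forall>i<n. norm (z i) \<le> 1 \<Longrightarrow> (\<Sum>i<n. g i (z i)) \<le> 1"
    "\<And>c. c \<in> C \<Longrightarrow> \<alpha> \<le> (\<Sum>i<n. g i (c i))"
proof -
  define J :: "(nat \<Rightarrow> 'z) \<Rightarrow> nat \<Rightarrow>\<^sub>C 'z" where "J z = Bcontfun (\<lambda>i. if i < n then z i else 0)" for z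
  have J: "apply_bcontfun (J z) = (\<lambda>i. if i < n then z i else 0)" for z
    unfolding J_def
  proof (rule Bcontfun_inverse)
    show "(\<lambda>i. if i < n then z i else 0) \<in> bcontfun"
    proof (rule bcontfun_normI)
      show "norm (if i < n then z i else 0) \<le> (\<Sum>i<n. norm (z i))" for i
        by (auto intro: member_le_sum sum_nonneg)
    qed simp
  qed
  have cJ: "convex (J ` C)"
  proof (rule convexI, clarify)
    fix c d and s t :: real assume *: "c \<in> C" "d \<in> C" "0 \<le> s" "0 \<le> t" "s + t = 1"
    have "s *\<^sub>R J c + t *\<^sub>R J d = J (\<lambda>i. s *\<^sub>R c i + t *\<^sub>R d i)"
      by (rule bcontfun_eqI) (simp add: J)
    then show "s *\<^sub>R J c + t *\<^sub>R J d \<in> J ` C" using convex[OF *] by blast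
  qed
  have "\<alpha> \<le> norm v" if v: "v \<in> J ` C" for v
  proof -
    obtain c where c: "c \<in> C" "v = J c" using v by blast
    then obtain i where "i < n" "\<alpha> \<le> norm (c i)" using far by blast
    then show ?thesis using norm_bounded[of v i] by (simp add: c J)
  qed
  then obtain f where f: "linear f" "\<And>v. f v \<le> norm v" "\<And>c. c \<in> J ` C \<Longrightarrow> \<alpha> \<le> f c"
    using convex_outside_ball_separation[OF cJ] C by (metis image_is_empty)
  define e :: "nat \<Rightarrow> 'z \<Rightarrow> nat \<Rightarrow>\<^sub>C 'z" where "e i z = J (\<lambda>j. if j = i then z else 0)" for i z
  have e_apply: "apply_bcontfun (e i z) j = (if j = i then if i < n then z else 0 else 0)" for i z j
    by (simp add: e_def J)
  have e: "linear (e i)" for i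
    by (rule linearI) (auto intro!: bcontfun_eqI simp: e_apply)
  have decomp: "(\<Sum>i<n. f (e i (z i))) = f (J z)" for z
  proof -
    have ap: "apply_bcontfun (\<Sum>i\<in>A. u i) j = (\<Sum>i\<in>A. apply_bcontfun (u i) j)"
      for A and u :: "nat \<Rightarrow> nat \<Rightarrow>\<^sub>C 'z" and j
      by (induction A rule: infinite_finite_induct) auto
    have "J z = (\<Sum>i<n. e i (z i))"
      by (rule bcontfun_eqI) (simp add: ap e_apply J)
    then show ?thesis using linear_sum[OF f(1), of "\<lambda>i. e i (z i)" "{..<n}"] by (simp add: o_def)
  qed
  have nJ: "norm (J z) \<le> r" if "\<And>i. i < n \<Longrightarrow> norm (z i) \<le> r" "0 \<le> r" for z r
    using that by (intro norm_bound) (auto simp: J)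
  show ?thesis
  proof
    show "bounded_linear (\<lambda>z. f (e i z))" for i
    proof (rule bounded_linear_intro[of _ 1])
      show "f (e i (x + y)) = f (e i x) + f (e i y)" for x y
        using f(1) e by (simp add: linear_add)
      show "f (e i (r *\<^sub>R x)) = r *\<^sub>R f (e i x)" for r x
        using f(1) e by (simp add: linear_cmul)
      show "norm (f (e i x)) \<le> norm x * 1" for x
      proof -
        have "norm (e i x) \<le> norm x" unfolding e_def by (rule nJ) auto
        then show ?thesis using f(2)[of "e i x"] f(2)[of "- e i x"] linear_neg[OF f(1), of "e i x"] by auto
      qed
    qed
    show "(\<Sum>i<n. f (e i (z i))) \<le> 1" if "\<forall>i<n. norm (z i) \<le> 1" for z
      unfolding decomp using f(2)[of "J z"] nJ[of z 1] that by fastforce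
    show "\<alpha> \<le> (\<Sum>i<n. f (e i (c i)))" if "c \<in> C" for c
      unfolding decomp using f(3) that by blast
  qed
qed

section \<open>Finite-dimensional subspaces\<close>

text \<open>Tychonoff's theorem, applied to all coordinates at once, with the ones outside \<open>B\<close> confined to
  a point.\<close>

lemma compact_coefficient_cube:
  fixes B :: "'a set"
  shows "compact {c :: 'a \<Rightarrow> real. (\<forall>b\<in>B. \<bar>c b\<bar> \<le> r) \<and> (\<forall>b. b \<notin> B \<longrightarrow> c b = 0)}"
proof -
  have "compactin (product_topology (\<lambda>_. euclideanreal) UNIV)
          (\<Pi>\<^sub>E b\<in>UNIV. if b \<in> B then {- r..r} else {0})"
    by (auto simp: compactin_PiE)
  moreover have "(\<Pi>\<^sub>E b\<in>UNIV. if b \<in> B then {- r..r} else {0}) =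
      {c. (\<forall>b\<in>B. \<bar>c b\<bar> \<le> r) \<and> (\<forall>b. b \<notin> B \<longrightarrow> c b = 0)}"
    by (auto simp: PiE_UNIV_domain Pi_iff abs_le_iff minus_le_iff split: if_splits)
  ultimately show ?thesis by (simp add: euclidean_product_topology)
qed

text \<open>The norm of the combination attains a minimum on the compact set of coefficients with absolute sum
  1, and that minimum is positive by independence.\<close>

lemma basis_norm_lower_bound:
  fixes B :: "'a::real_normed_vector set"
  assumes B: "finite B" "independent B"
  obtains m where "0 < m" "\<And>c :: 'a \<Rightarrow> real. m * (\<Sum>b\<in>B. \<bar>c b\<bar>) \<le> norm (\<Sum>b\<in>B. c b *\<^sub>R b)"
proof -
  define K where "K = {c :: 'a \<Rightarrow> real. (\<forall>b\<in>B. \<bar>c b\<bar> \<le> 1) \<and> (\<forall>b. b \<notin> B \<longrightarrow> c b = 0)}"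
  define S where "S = K \<inter> {c. (\<Sum>b\<in>B. \<bar>c b\<bar>) = 1}"
  have "closed {c :: 'a \<Rightarrow> real. (\<Sum>b\<in>B. \<bar>c b\<bar>) = 1}"
    by (intro closed_Collect_eq continuous_intros continuous_on_product_coordinates)
  then have S: "compact S" unfolding S_def K_def by (intro compact_Int_closed compact_coefficient_cube)
  have cont: "continuous_on S (\<lambda>c. norm (\<Sum>b\<in>B. c b *\<^sub>R b))"
    by (intro continuous_intros continuous_on_subset[OF continuous_on_product_coordinates]) auto
  obtain m where m: "0 < m" "\<And>c. c \<in> S \<Longrightarrow> m \<le> norm (\<Sum>b\<in>B. c b *\<^sub>R b)"
  proof (cases "S = {}")
    case True
    then show ?thesis using that[of 1] by simp
  next
    case False
    obtain d where d: "d \<in> S" "\<And>c. c \<in> S \<Longrightarrow> norm (\<Sum>b\<in>B. d b *\<^sub>R b) \<le> norm (\<Sum>b\<in>B. c b *\<^sub>R b)"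
      using continuous_attains_inf[OF S False cont] by blast
    have "(\<Sum>b\<in>B. d b *\<^sub>R b) \<noteq> 0"
    proof
      assume "(\<Sum>b\<in>B. d b *\<^sub>R b) = 0"
      then have "\<forall>b\<in>B. d b = 0" using independentD[OF B(2) B(1) subset_refl] by blast
      then show False using d(1) by (simp add: S_def)
    qed
    with d(2) that[of "norm (\<Sum>b\<in>B. d b *\<^sub>R b)"] show ?thesis by simp
  qed
  show ?thesis
  proof (rule that[OF m(1)])
    fix c :: "'a \<Rightarrow> real"
    define s where "s = (\<Sum>b\<in>B. \<bar>c b\<bar>)"
    show "m * (\<Sum>b\<in>B. \<bar>c b\<bar>) \<le> norm (\<Sum>b\<in>B. c b *\<^sub>R b)"
    proof (cases "s = 0")
      case True
      then show ?thesis by (simp add: s_def)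
    next
      case False
      then have s: "0 < s" by (simp add: s_def sum_nonneg less_le)
      define d where "d b = (if b \<in> B then c b / s else 0)" for b
      have "\<bar>c b\<bar> \<le> s" if "b \<in> B" for b unfolding s_def using that B(1) by (intro member_le_sum) auto
      moreover have "(\<Sum>b\<in>B. \<bar>d b\<bar>) = 1"
        using s by (simp add: d_def abs_divide s_def flip: sum_divide_distrib)
      ultimately have "d \<in> S" using s by (auto simp: S_def K_def d_def abs_divide)
      from m(2)[OF this] have "m \<le> norm (inverse s *\<^sub>R (\<Sum>b\<in>B. c b *\<^sub>R b))"
        by (simp add: d_def scaleR_sum_right divide_inverse mult.commute cong: sum.cong)
      then show ?thesis using s by (simp add: s_def[symmetric] field_simps)
    qed
  qed
qed

text \<open>Unit vectors have bounded coefficients, so the sphere is the intersection of a closed set with the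
  continuous image of a coefficient cube.\<close>

lemma compact_sphere_span:
  fixes B :: "'a::real_normed_vector set"
  assumes B: "finite B" "independent B"
  shows "compact {e \<in> span B. norm e = 1}"
proof -
  obtain m where m: "0 < m" "\<And>c. m * (\<Sum>b\<in>B. \<bar>c b\<bar>) \<le> norm (\<Sum>b\<in>B. c b *\<^sub>R b)"
    using basis_norm_lower_bound[OF B] by blast
  define K where "K = {c :: 'a \<Rightarrow> real. (\<forall>b\<in>B. \<bar>c b\<bar> \<le> 1 / m) \<and> (\<forall>b. b \<notin> B \<longrightarrow> c b = 0)}"
  let ?\<Phi> = "\<lambda>c. \<Sum>b\<in>B. c b *\<^sub>R b"
  have "compact (?\<Phi> ` K)"
    unfolding K_def
    by (intro compact_continuous_image compact_coefficient_cube continuous_intros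
        continuous_on_subset[OF continuous_on_product_coordinates]) auto
  moreover have "closed {e :: 'a. norm e = 1}"
    by (intro closed_Collect_eq continuous_intros)
  ultimately have "compact (?\<Phi> ` K \<inter> {e. norm e = 1})" by (rule compact_Int_closed)
  moreover have "{e \<in> span B. norm e = 1} = ?\<Phi> ` K \<inter> {e. norm e = 1}"
  proof (intro equalityI subsetI)
    fix e assume e: "e \<in> {e \<in> span B. norm e = 1}"
    define c where "c = representation B e"
    have eq: "e = ?\<Phi> c" unfolding c_def
      using e sum_representation_eq[OF B(2) _ B(1) subset_refl, of e] by simp
    have "\<bar>c b\<bar> \<le> 1 / m" if "b \<in> B" for b
    proof -
      have "\<bar>c b\<bar> \<le> (\<Sum>b\<in>B. \<bar>c b\<bar>)" using that B(1) by (intro member_le_sum) auto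
      also have "\<dots> \<le> 1 / m" using m(2)[of c] e m(1) by (simp add: eq[symmetric] field_simps)
      finally show ?thesis .
    qed
    moreover have "c b = 0" if "b \<notin> B" for b
      using that representation_ne_zero[of B e b] by (auto simp: c_def)
    ultimately have "c \<in> K" by (simp add: K_def)
    with e eq show "e \<in> ?\<Phi> ` K \<inter> {e. norm e = 1}" by auto
  qed (auto intro: span_sum span_scale span_base)
  ultimately show ?thesis by simp
qed

lemma linear_bounded_on_span:
  fixes T :: "'a::real_normed_vector \<Rightarrow> 'b::real_normed_vector"
  assumes B: "finite B" "independent B" and T: "linear T"
  obtains K where "\<And>e. e \<in> span B \<Longrightarrow> norm (T e) \<le> K * norm e"
proof -
  obtain m where m: "0 < m" "\<And>c. m * (\<Sum>b\<in>B. \<bar>c b\<bar>) \<le> norm (\<Sum>b\<in>B. c b *\<^sub>R b)"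
    using basis_norm_lower_bound[OF B] by blast
  define L where "L = (\<Sum>b\<in>B. norm (T b))"
  have "norm (T e) \<le> L / m * norm e" if "e \<in> span B" for e
  proof -
    define c where "c = representation B e"
    have eq: "e = (\<Sum>b\<in>B. c b *\<^sub>R b)" unfolding c_def
      using sum_representation_eq[OF B(2) that B(1) subset_refl] by simp
    have "T e = (\<Sum>b\<in>B. c b *\<^sub>R T b)"
      by (subst eq) (simp add: linear_sum[OF T] linear_cmul[OF T] o_def)
    also have "norm \<dots> \<le> (\<Sum>b\<in>B. \<bar>c b\<bar> * norm (T b))"
      by (rule sum_norm_le) simp
    also have "\<dots> \<le> (\<Sum>b\<in>B. \<bar>c b\<bar> * L)"
      unfolding L_def using B(1) by (intro sum_mono mult_left_mono member_le_sum) auto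
    also have "\<dots> = L * (\<Sum>b\<in>B. \<bar>c b\<bar>)" by (simp add: sum_distrib_left mult.commute)
    also have "\<dots> \<le> L * (norm e / m)"
      using m(2)[of c] m(1) by (intro mult_left_mono) (auto simp: eq[symmetric] field_simps L_def sum_nonneg)
    finally show ?thesis by simp
  qed
  then show ?thesis by (rule that)
qed

text \<open>Let \<open>M\<close> be the norm of \<open>T\<close> on the span. Every unit vector is \<open>\<delta>\<close>-close to the net, so
  \<open>M \<le> 1 + \<delta> + M \<delta>\<close>; as \<open>M\<close> is finite, \<open>M \<le> (1 + \<delta>) / (1 - \<delta>) \<le> 1 + 3 \<delta> \<le> 2\<close>. The same approximation
  then gives the lower bound \<open>1 - 2 \<delta> - M \<delta> \<ge> 1 - 4 \<delta>\<close>.\<close>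

lemma almost_isometric_on_net:
  fixes T :: "'a::real_normed_vector \<Rightarrow> 'b::real_normed_vector"
  assumes B: "finite B" "independent B" and T: "linear T"
    and \<delta>: "0 < \<delta>" "\<delta> \<le> 1 / 3"
    and N: "N \<subseteq> span B" "{e \<in> span B. norm e = 1} \<subseteq> (\<Union>y\<in>N. ball y \<delta>)"
    and up: "\<And>y. y \<in> N \<Longrightarrow> norm (T y) \<le> 1 + \<delta>"
    and low: "\<And>y. y \<in> N \<Longrightarrow> 1 - 2 * \<delta> \<le> norm (T y)"
    and e: "e \<in> span B"
  shows "(1 - 4 * \<delta>) * norm e \<le> norm (T e)" "norm (T e) \<le> (1 + 3 * \<delta>) * norm e"
proof -
  define S where "S = {e \<in> span B. norm e = 1}"
  obtain K where K: "\<And>e. e \<in> span B \<Longrightarrow> norm (T e) \<le> K * norm e"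
    using linear_bounded_on_span[OF B T] by blast
  define M where "M = (SUP e\<in>S. norm (T e))"
  have bdd: "bdd_above ((\<lambda>e. norm (T e)) ` S)"
    using K by (intro bdd_aboveI2[of _ _ K]) (force simp: S_def)
  have le_M: "norm (T e) \<le> M" if "e \<in> S" for e
    unfolding M_def using bdd that by (rule cSUP_upper[rotated])
  have normalize: "norm (T e) = norm e * norm (T (inverse (norm e) *\<^sub>R e)) \<and> inverse (norm e) *\<^sub>R e \<in> S"
    if "e \<in> span B" "e \<noteq> 0" for e
    using that by (simp add: S_def span_scale linear_cmul[OF T])
  have scaled: "norm (T e) \<le> M * norm e" if "e \<in> span B" for e
  proof (cases "e = 0")
    case True
    then show ?thesis by (simp add: linear_0[OF T])
  next
    case False
    with normalize[OF that False] le_M show ?thesis by (simp add: mult.commute mult_left_mono)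
  qed
  have near: "\<exists>y\<in>N. norm (T (e - y)) \<le> M * \<delta>" if S0: "e \<in> S" for e
  proof -
    obtain y where y: "y \<in> N" "norm (e - y) < \<delta>"
      using N(2) S0 by (auto simp: S_def dist_norm norm_minus_commute)
    have "0 \<le> M" using le_M[OF S0] norm_ge_zero order_trans by blast
    moreover have "e - y \<in> span B" using y N(1) S0 by (auto simp: S_def intro: span_diff)
    ultimately have "norm (T (e - y)) \<le> M * \<delta>"
      using scaled[of "e - y"] y(2) mult_left_mono[of "norm (e - y)" \<delta> M] by linarith
    with y show ?thesis by blast
  qed
  have main: "1 - 4 * \<delta> \<le> norm (T u) \<and> norm (T u) \<le> 1 + 3 * \<delta>" if u: "u \<in> S" for u
  proof -
    have "norm (T v) \<le> 1 + \<delta> + M * \<delta>" if "v \<in> S" for v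
    proof -
      obtain y where y: "y \<in> N" "norm (T (v - y)) \<le> M * \<delta>" using near \<open>v \<in> S\<close> by blast
      then show ?thesis
        using up[OF y(1)] norm_triangle_sub[of "T v" "T y"] by (simp add: linear_diff[OF T])
    qed
    then have "M \<le> 1 + \<delta> + M * \<delta>"
      unfolding M_def[symmetric] using u by (subst M_def, intro cSUP_least) auto
    then have "M * (1 - \<delta>) \<le> 1 + \<delta>" by (simp add: algebra_simps)
    also have "\<dots> \<le> (1 + 3 * \<delta>) * (1 - \<delta>)"
      using \<delta> mult_right_mono[of "\<delta>" "1 / 3" \<delta>] by (simp add: algebra_simps)
    finally have M: "M \<le> 1 + 3 * \<delta>" using \<delta> by (simp add: mult_le_cancel_right)
    have "M * \<delta> \<le> 2 * \<delta>" using M \<delta> by (intro mult_right_mono) auto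
    moreover obtain y where y: "y \<in> N" "norm (T (u - y)) \<le> M * \<delta>" using near u by blast
    then have "1 - 2 * \<delta> \<le> norm (T u) + M * \<delta>"
      using low[OF y(1)] norm_triangle_sub[of "T y" "T u"]
      by (simp add: linear_diff[OF T] norm_minus_commute)
    ultimately show ?thesis using le_M[OF u] M by linarith
  qed
  show "(1 - 4 * \<delta>) * norm e \<le> norm (T e)" "norm (T e) \<le> (1 + 3 * \<delta>) * norm e"
    using normalize[OF e] main[of "inverse (norm e) *\<^sub>R e"]
    by (cases "e = 0"; simp add: linear_0[OF T] mult.commute mult_right_mono)+
qed

section \<open>Functionals on a subspace and their extensions\<close>

lemma dual_spaceI:
  assumes "linear_on X f" "\<And>x. x \<in> X \<Longrightarrow> \<bar>f x\<bar> \<le> K * norm x" "\<And>x. x \<notin> X \<Longrightarrow> f x = 0"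
  shows "f \<in> dual_space X"
  unfolding dual_space_def mem_Collect_eq using assms by blast

lemma dual_spaceD:
  assumes "f \<in> dual_space X"
  shows "linear_on X f" "\<exists>K. \<forall>x\<in>X. \<bar>f x\<bar> \<le> K * norm x" "x \<notin> X \<Longrightarrow> f x = 0"
  using assms unfolding dual_space_def mem_Collect_eq by blast+

lemma dual_space_add:
  assumes f: "f \<in> dual_space X" and g: "g \<in> dual_space X"
  shows "(\<lambda>x. f x + g x) \<in> dual_space X"
proof -
  obtain K where K: "\<forall>x\<in>X. \<bar>f x\<bar> \<le> K * norm x" using dual_spaceD(2)[OF f] ..
  obtain L where L: "\<forall>x\<in>X. \<bar>g x\<bar> \<le> L * norm x" using dual_spaceD(2)[OF g] ..
  show ?thesis
  proof (rule dual_spaceI)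
    show "linear_on X (\<lambda>x. f x + g x)"
      using dual_spaceD(1)[OF f] dual_spaceD(1)[OF g] by (simp add: linear_on_def distrib_left)
    show "\<bar>f x + g x\<bar> \<le> (K + L) * norm x" if "x \<in> X" for x
      using bspec[OF K that] bspec[OF L that] by (simp add: distrib_right)
    show "f x + g x = 0" if "x \<notin> X" for x
      using that by (simp add: dual_spaceD(3)[OF f] dual_spaceD(3)[OF g])
  qed
qed

lemma dual_space_scale:
  assumes f: "f \<in> dual_space X"
  shows "(\<lambda>x. c * f x) \<in> dual_space X"
proof -
  obtain K where K: "\<forall>x\<in>X. \<bar>f x\<bar> \<le> K * norm x" using dual_spaceD(2)[OF f] ..
  show ?thesis
  proof (rule dual_spaceI)
    show "linear_on X (\<lambda>x. c * f x)"
      using dual_spaceD(1)[OF f] by (simp add: linear_on_def distrib_left)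
    show "\<bar>c * f x\<bar> \<le> (\<bar>c\<bar> * K) * norm x" if "x \<in> X" for x
      using mult_left_mono[OF bspec[OF K that], of "\<bar>c\<bar>"] by (simp add: abs_mult mult.assoc)
    show "c * f x = 0" if "x \<notin> X" for x
      using that by (simp add: dual_spaceD(3)[OF f])
  qed
qed

lemma zero_in_dual_space: "(\<lambda>x. 0) \<in> dual_space X"
  by (rule dual_spaceI[of _ _ 0]) (simp_all add: linear_on_def)

lemma dual_space_sum:
  assumes "\<And>i. i \<in> I \<Longrightarrow> h i \<in> dual_space X"
  shows "(\<lambda>x. \<Sum>i\<in>I. c i * h i x) \<in> dual_space X"
  using assms
  by (induction I rule: infinite_finite_induct)
     (auto simp: zero_in_dual_space intro!: dual_space_add dual_space_scale)

lemma restriction_in_dual_space: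
  assumes "subspace X" "bounded_linear g"
  shows "(\<lambda>x. if x \<in> X then g x else 0) \<in> dual_space X"
proof -
  interpret bounded_linear g by fact
  obtain K where "\<And>x. norm (g x) \<le> norm x * K" using bounded by blast
  then show ?thesis
    using assms(1)
    by (intro dual_spaceI[of _ _ K])
       (auto simp: linear_on_def add scale subspace_add subspace_scale mult.commute)
qed

locale extension_operator =
  fixes X :: "'a::real_normed_vector set" and \<phi> :: "('a \<Rightarrow> real) \<Rightarrow> ('a \<Rightarrow>\<^sub>L real)"
  assumes X: "subspace X" and extension: "hahn_banach_extension_operator X \<phi>"
begin

lemma extends: "f \<in> dual_space X \<Longrightarrow> x \<in> X \<Longrightarrow> blinfun_apply (\<phi> f) x = f x"
  and norm_extension: "f \<in> dual_space X \<Longrightarrow> norm (\<phi> f) = dual_norm X f"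
  using extension by (auto simp: hahn_banach_extension_operator_def)

lemma extension_add:
  "f \<in> dual_space X \<Longrightarrow> g \<in> dual_space X \<Longrightarrow> \<phi> (\<lambda>x. f x + g x) = \<phi> f + \<phi> g"
  and extension_scale: "f \<in> dual_space X \<Longrightarrow> \<phi> (\<lambda>x. c * f x) = c *\<^sub>R \<phi> f"
  using extension by (auto simp: hahn_banach_extension_operator_def)

lemma extension_zero: "\<phi> (\<lambda>x. 0) = 0"
  using extension_scale[OF zero_in_dual_space, of 0] by simp

lemma extension_sum:
  assumes "\<And>i. i \<in> I \<Longrightarrow> h i \<in> dual_space X"
  shows "\<phi> (\<lambda>x. \<Sum>i\<in>I. c i * h i x) = (\<Sum>i\<in>I. c i *\<^sub>R \<phi> (h i))"
  using assms
  by (induction I rule: infinite_finite_induct)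
     (auto simp: extension_zero extension_add extension_scale dual_space_sum dual_space_scale)

text \<open>The dual of a finite maximum-norm product is the sum-norm product of the duals. Only vectors
  of \<open>X\<close> are tested, since the dual norm on \<open>X\<close> sees no others.\<close>

lemma sum_dual_norm_le:
  fixes n :: nat
  assumes g: "\<And>i. i < n \<Longrightarrow> g i \<in> dual_space X"
    and le: "\<And>z. (\<And>i. i < n \<Longrightarrow> z i \<in> X \<and> norm (z i) \<le> 1) \<Longrightarrow> (\<Sum>i<n. g i (z i)) \<le> r"
  shows "(\<Sum>i<n. dual_norm X (g i)) \<le> r"
proof (rule field_le_epsilon)
  fix \<epsilon> :: real assume "0 < \<epsilon>"
  define \<eta> where "\<eta> = \<epsilon> / (real n + 1)"
  have \<eta>: "0 < \<eta>" "real n * \<eta> \<le> \<epsilon>" using \<open>0 < \<epsilon>\<close> by (auto simp: \<eta>_def field_simps)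
  have "\<exists>z\<in>X. norm z \<le> 1 \<and> dual_norm X (g i) - \<eta> \<le> g i z" if i: "i < n" for i
  proof -
    have "dual_norm X (g i) - \<eta> < Sup {\<bar>g i x\<bar> |x. x \<in> X \<and> norm x \<le> 1}"
      using \<eta> by (simp add: dual_norm_def)
    moreover have "{\<bar>g i x\<bar> |x. x \<in> X \<and> norm x \<le> 1} \<noteq> {}"
      using subspace_0[OF X] by (auto intro!: exI[of _ 0])
    ultimately obtain x where x: "x \<in> X" "norm x \<le> 1" "dual_norm X (g i) - \<eta> < \<bar>g i x\<bar>"
      by (elim less_cSupE) auto
    have "g i (- x) = - g i x"
      using g[OF i] x(1) extends[OF g[OF i]] subspace_neg[OF X x(1)]
      by (metis blinfun.minus_right)
    with x subspace_neg[OF X x(1)] show ?thesis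
      by (cases "0 \<le> g i x") (force intro: bexI[of _ x] bexI[of _ "- x"])+
  qed
  then obtain z where z: "\<And>i. i < n \<Longrightarrow> z i \<in> X \<and> norm (z i) \<le> 1 \<and> dual_norm X (g i) - \<eta> \<le> g i (z i)"
    by metis
  have "(\<Sum>i<n. dual_norm X (g i)) - real n * \<eta> = (\<Sum>i<n. dual_norm X (g i) - \<eta>)"
    by (simp add: sum_subtractf)
  also have "\<dots> \<le> (\<Sum>i<n. g i (z i))" using z by (intro sum_mono) auto
  also have "\<dots> \<le> r" using z by (intro le) auto
  finally show "(\<Sum>i<n. dual_norm X (g i)) \<le> r + \<epsilon>" using \<eta> by simp
qed

section \<open>Local reflexivity through an extension operator\<close>

text \<open>The competitors for the almost isometry. They are taken linear on the whole space, as a linear map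
  on \<open>E\<close> always extends; only their values on \<open>E\<close> are constrained.\<close>

definition local_projections :: "'a set \<Rightarrow> ('a \<Rightarrow> 'a) set" where
  "local_projections E = {T. linear T \<and> T ` E \<subseteq> X \<and> (\<forall>e\<in>X \<inter> E. T e = e)}"

text \<open>In terms of the bidual: the embedding of \<open>E\<close> given by \<open>\<phi>\<close> agrees with some operator into \<open>X\<close> as far as
  one finite sum of evaluations can tell. Expanding the \<open>y i\<close> in a basis of \<open>E\<close> that contains a basis of
  \<open>X \<inter> E\<close>, and using linearity of \<open>\<phi>\<close>, collects the sum into \<open>\<Sum>\<^sub>b \<phi> (H b) b\<close> with functionals \<open>H b\<close> on \<open>X\<close>.
  So it suffices to send each basis vector \<open>b\<close> to some \<open>x b \<in> X\<close> with \<open>H b (x b) = \<phi> (H b) b\<close>. If \<open>b \<in> X\<close> then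
  \<open>b\<close> itself will do; otherwise \<open>H b\<close> either attains every real value on \<open>X\<close> or vanishes, and in the latter
  case \<open>\<phi> (H b) = 0\<close>.\<close>

lemma local_projection_matching_extension:
  fixes y :: "nat \<Rightarrow> 'a"
  assumes E: "subspace E" "finite F" "E = span F"
    and y: "\<And>i. i < n \<Longrightarrow> y i \<in> E"
    and h: "\<And>i. i < n \<Longrightarrow> h i \<in> dual_space X"
  obtains T where "T \<in> local_projections E"
    "(\<Sum>i<n. h i (T (y i))) = (\<Sum>i<n. blinfun_apply (\<phi> (h i)) (y i))"
proof -
  obtain B0 where B0: "B0 \<subseteq> X \<inter> E" "independent B0" "X \<inter> E \<subseteq> span B0"
    using maximal_independent_subset[of "X \<inter> E"] by blast
  obtain B where B: "B0 \<subseteq> B" "B \<subseteq> E" "independent B" "E \<subseteq> span B"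
    using maximal_independent_subset_extend[of B0 E] B0 by blast
  have fin: "finite B"
    using independent_span_bound[OF E(2) B(3)] B(2) E(3) by blast
  define c where "c i b = representation B (y i) b" for i b
  define H where "H b x = (\<Sum>i<n. c i b * h i x)" for b x
  have H: "H b \<in> dual_space X" for b unfolding H_def using h by (intro dual_space_sum) auto
  have \<phi>H: "\<phi> (H b) = (\<Sum>i<n. c i b *\<^sub>R \<phi> (h i))" for b
    unfolding H_def using h by (intro extension_sum) auto
  have "\<exists>x\<in>X. blinfun_apply (\<phi> (H b)) x = blinfun_apply (\<phi> (H b)) b \<and> (b \<in> X \<longrightarrow> x = b)" for b
  proof (cases "b \<in> X")
    case False
    show ?thesis
    proof (cases "\<forall>x\<in>X. H b x = 0")
      case True
      then have "H b = (\<lambda>x. 0)" using dual_spaceD(3)[OF H[of b]] by fastforce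
      then have "\<phi> (H b) = 0" by (simp add: extension_zero)
      then show ?thesis using False subspace_0[OF X] by auto
    next
      case nz: False
      then obtain x where x: "x \<in> X" "H b x \<noteq> 0" by blast
      let ?x = "(blinfun_apply (\<phi> (H b)) b / H b x) *\<^sub>R x"
      have "blinfun_apply (\<phi> (H b)) ?x = blinfun_apply (\<phi> (H b)) b"
        using x extends[OF H x(1)] by (simp add: blinfun.scaleR_right)
      then show ?thesis using False subspace_scale[OF X x(1)] by blast
    qed
  qed auto
  then obtain x where x: "\<And>b. x b \<in> X"
      "\<And>b. blinfun_apply (\<phi> (H b)) (x b) = blinfun_apply (\<phi> (H b)) b" "\<And>b. b \<in> X \<Longrightarrow> x b = b"
    by metis
  define T where "T = construct B x"
  have T: "linear T" "\<And>b. b \<in> B \<Longrightarrow> T b = x b"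
    unfolding T_def using linear_construct[OF B(3)] construct_basis[OF B(3)] by auto
  have TX: "T e \<in> X" for e
  proof -
    have "span (x ` B) \<subseteq> X" using x(1) X by (intro span_minimal) auto
    then show ?thesis unfolding T_def using construct_in_span[OF B(3)] by blast
  qed
  have Tid: "T e = e" if "e \<in> X \<inter> E" for e
  proof (rule linear_eq_on[OF T(1) linear_id, of e B0, unfolded id_def])
    show "e \<in> span B0" using that B0(3) by blast
    show "T b = b" if "b \<in> B0" for b using that B0(1) B(1) T(2)[of b] x(3)[of b] by (metis IntD1 subsetD)
  qed
  have yB: "y i = (\<Sum>b\<in>B. c i b *\<^sub>R b)" if "i < n" for i
    using sum_representation_eq[OF B(3) _ fin subset_refl, of "y i"] y[OF that] B(4)
    by (auto simp: c_def)
  have TyB: "T (y i) = (\<Sum>b\<in>B. c i b *\<^sub>R x b)" if "i < n" for i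
    unfolding yB[OF that] using T by (simp add: linear_sum linear_cmul)
  have swap: "(\<Sum>i<n. blinfun_apply (\<phi> (h i)) (\<Sum>b\<in>B. c i b *\<^sub>R u b)) =
      (\<Sum>b\<in>B. blinfun_apply (\<phi> (H b)) (u b))" for u
    by (simp add: \<phi>H blinfun.sum_right blinfun.sum_left blinfun.scaleR_right blinfun.scaleR_left)
       (rule sum.swap)
  have "(\<Sum>i<n. h i (T (y i))) = (\<Sum>i<n. blinfun_apply (\<phi> (h i)) (\<Sum>b\<in>B. c i b *\<^sub>R x b))"
    by (intro sum.cong) (simp_all add: extends[OF h TX] flip: TyB)
  also have "\<dots> = (\<Sum>i<n. blinfun_apply (\<phi> (h i)) (\<Sum>b\<in>B. c i b *\<^sub>R b))"
    by (simp only: swap x(2))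
  also have "\<dots> = (\<Sum>i<n. blinfun_apply (\<phi> (h i)) (y i))"
    using yB by (intro sum.cong) auto
  finally show ?thesis using T(1) TX Tid by (intro that[of T]) (auto simp: local_projections_def)
qed

text \<open>The norm bounds and the approximate equations are both convex conditions on \<open>T\<close>, and one
  separation argument handles them together: they hold as soon as the pairs
  \<open>(T (y i), M (\<phi> (f i) (y i) - f i (T (y i))))\<close> have norm less than \<open>1 + \<eta>\<close>, provided
  \<open>M\<close> is large. A separating functional would take a value of at most 1 at the ideal tuple \<open>(y i, 0)\<close>, and
  by the preceding lemma some \<open>T\<close> gives it exactly that value.\<close>

lemma approximate_local_reflexivity:
  fixes y :: "nat \<Rightarrow> 'a"
  assumes E: "subspace E" "finite F" "E = span F"
    and y: "\<And>i. i < n \<Longrightarrow> y i \<in> E" "\<And>i. i < n \<Longrightarrow> norm (y i) \<le> 1"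
    and f: "\<And>i. i < n \<Longrightarrow> f i \<in> dual_space X"
    and \<eta>: "0 < \<eta>"
  obtains T where "T \<in> local_projections E"
    "\<And>i. i < n \<Longrightarrow> norm (T (y i)) < 1 + \<eta>"
    "\<And>i. i < n \<Longrightarrow> \<bar>blinfun_apply (\<phi> (f i)) (y i) - f i (T (y i))\<bar> < \<eta>"
proof -
  (* A real coordinate of absolute value less than 1 + \<eta> then encodes an error less than \<eta>. *)
  define M where "M = (1 + \<eta>) / \<eta>"
  have M: "0 < M" "(1 + \<eta>) / M = \<eta>" using \<eta> by (auto simp: M_def field_simps)
  define a where "a i = blinfun_apply (\<phi> (f i)) (y i)" for i
  (* Set to 0 beyond n, where f i need not be linear, so that the tuples form a convex set of functions. *)
  define A :: "('a \<Rightarrow> 'a) \<Rightarrow> nat \<Rightarrow> 'a \<times> real"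
    where "A T i = (if i < n then (T (y i), M * (a i - f i (T (y i)))) else 0)" for T i
  have "\<exists>T\<in>local_projections E. \<forall>i<n. norm (A T i) < 1 + \<eta>"
  proof (rule ccontr)
    assume "\<not> ?thesis"
    then have far: "\<exists>i<n. 1 + \<eta> \<le> norm (A T i)" if "T \<in> local_projections E" for T
      using that by (meson not_le)
    have ne: "local_projections E \<noteq> {}"
      using local_projection_matching_extension[OF E, of 0] by auto
    have convex: "(\<lambda>i. s *\<^sub>R c i + t *\<^sub>R d i) \<in> A ` local_projections E"
      if cd: "c \<in> A ` local_projections E" "d \<in> A ` local_projections E"
        and st: "0 \<le> s" "0 \<le> t" "s + t = 1" for c d s t
    proof -
      obtain T U where T: "T \<in> local_projections E" "c = A T" and U: "U \<in> local_projections E" "d = A U"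
        using cd by blast
      define V where "V e = s *\<^sub>R T e + t *\<^sub>R U e" for e
      have "linear V" unfolding V_def using T U
        by (auto simp: local_projections_def intro!: linear_compose_add linear_compose_scale_right)
      moreover have "V e \<in> X" if "e \<in> E" for e
        using that T U X by (auto simp: V_def local_projections_def intro!: subspace_add subspace_scale)
      moreover have "V e = e" if "e \<in> X \<inter> E" for e
        using that T U st by (auto simp: V_def local_projections_def simp flip: scaleR_add_left)
      ultimately have V: "V \<in> local_projections E" by (auto simp: local_projections_def)
      have "A V i = s *\<^sub>R A T i + t *\<^sub>R A U i" for i
      proof (cases "i < n")
        case True
        then have "T (y i) \<in> X" "U (y i) \<in> X" "V (y i) \<in> X"
          using T U V y by (auto simp: local_projections_def)
        then have fV: "f i (V (y i)) = s * f i (T (y i)) + t * f i (U (y i))"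
          using extends[OF f[OF True]] by (metis V_def blinfun.add_right blinfun.scaleR_right real_scaleR_def)
        have "M * (a i - f i (V (y i))) =
            M * ((s + t) * a i - (s * f i (T (y i)) + t * f i (U (y i))))"
          by (simp add: fV st)
        also have "\<dots> = s * (M * (a i - f i (T (y i)))) + t * (M * (a i - f i (U (y i))))"
          by (simp add: algebra_simps)
        finally have "M * (a i - f i (V (y i))) =
            s * (M * (a i - f i (T (y i)))) + t * (M * (a i - f i (U (y i))))" .
        with True show ?thesis by (simp add: A_def V_def)
      qed (simp add: A_def)
      then have "(\<lambda>i. s *\<^sub>R c i + t *\<^sub>R d i) = A V" using T U by auto
      with V show ?thesis by blast
    qed
    have far_image: "\<exists>i<n. 1 + \<eta> \<le> norm (c i)" if "c \<in> A ` local_projections E" for c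
      using that far by blast
    have "A ` local_projections E \<noteq> {}" using ne by blast
    then obtain g where g: "\<And>i. bounded_linear (g i)"
      "\<And>z. \<forall>i<n. norm (z i) \<le> 1 \<Longrightarrow> (\<Sum>i<n. g i (z i)) \<le> 1"
      "\<And>c. c \<in> A ` local_projections E \<Longrightarrow> 1 + \<eta> \<le> (\<Sum>i<n. g i (c i))"
      using convex far_image
      by (rule finite_family_separation[of "A ` local_projections E" n "1 + \<eta>"]) (assumption | blast)+
    (* k i is the part of g i seen by vectors of X, and t i its slope in the real coordinate. *)
    define k where "k i x = (if x \<in> X then g i (x, 0) else 0)" for i x
    define t where "t i = g i (0, 1)" for i
    have k: "k i \<in> dual_space X" for i
      unfolding k_def
      by (intro restriction_in_dual_space[OF X] bounded_linear_compose[OF g(1)]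
          bounded_linear_Pair bounded_linear_ident bounded_linear_zero)
    have gA: "g i (x, r) = k i x + r * t i" if "x \<in> X" for i x r
    proof -
      interpret bounded_linear "g i" by fact
      have "g i (x, r) = g i ((x, 0) + r *\<^sub>R (0, 1))" by simp
      then show ?thesis unfolding add scale using that by (simp add: k_def t_def)
    qed
    (* h i collects the dependence of the i-th summand on the vector T (y i). *)
    define h where "h i x = k i x + (- M * t i) * f i x" for i x
    have h: "h i \<in> dual_space X" if "i < n" for i
      unfolding h_def using k f[OF that] by (intro dual_space_add dual_space_scale)
    have \<phi>h: "blinfun_apply (\<phi> (h i)) (y i) = blinfun_apply (\<phi> (k i)) (y i) - M * t i * a i" if "i < n" for i
      unfolding h_def a_def extension_add[OF k dual_space_scale[OF f[OF that]]] extension_scale[OF f[OF that]]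
      by (simp add: blinfun.diff_left blinfun.scaleR_left)
    obtain T where T: "T \<in> local_projections E"
      "(\<Sum>i<n. h i (T (y i))) = (\<Sum>i<n. blinfun_apply (\<phi> (h i)) (y i))"
      using local_projection_matching_extension[of E F n y h, OF E y(1) h] by blast
    have "1 + \<eta> \<le> (\<Sum>i<n. g i (A T i))" by (rule g(3)[OF imageI[OF T(1)]])
    also have "\<dots> = (\<Sum>i<n. h i (T (y i)) + M * t i * a i)"
    proof (intro sum.cong refl)
      fix i assume "i \<in> {..<n}"
      then have "T (y i) \<in> X" using T(1) y by (auto simp: local_projections_def)
      then show "g i (A T i) = h i (T (y i)) + M * t i * a i"
        using \<open>i \<in> {..<n}\<close> by (simp add: A_def gA h_def algebra_simps)
    qed
    also have "\<dots> = (\<Sum>i<n. blinfun_apply (\<phi> (k i)) (y i))"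
      by (simp add: sum.distrib T(2) \<phi>h sum_subtractf)
    also have "\<dots> \<le> (\<Sum>i<n. dual_norm X (k i))"
    proof (intro sum_mono)
      fix i assume "i \<in> {..<n}"
      have "blinfun_apply (\<phi> (k i)) (y i) \<le> norm (\<phi> (k i)) * norm (y i)"
        using norm_blinfun[of "\<phi> (k i)" "y i"] by simp
      also have "\<dots> \<le> norm (\<phi> (k i)) * 1"
        using y(2) \<open>i \<in> {..<n}\<close> by (intro mult_left_mono) auto
      finally show "blinfun_apply (\<phi> (k i)) (y i) \<le> dual_norm X (k i)"
        by (simp add: norm_extension[OF k])
    qed
    also have "\<dots> \<le> 1"
    proof (rule sum_dual_norm_le[OF k])
      fix z assume z: "\<And>i. i < n \<Longrightarrow> z i \<in> X \<and> norm (z i) \<le> 1"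
      have "(\<Sum>i<n. k i (z i)) = (\<Sum>i<n. g i (z i, 0))" using z by (intro sum.cong) (auto simp: k_def)
      also have "\<dots> \<le> 1" using z by (intro g(2)) (simp add: norm_Pair)
      finally show "(\<Sum>i<n. k i (z i)) \<le> 1" .
    qed
    finally show False using \<eta> by simp
  qed
  then obtain T where T: "T \<in> local_projections E" "\<And>i. i < n \<Longrightarrow> norm (A T i) < 1 + \<eta>" by blast
  show ?thesis
  proof
    show "T \<in> local_projections E" by fact
    fix i assume i: "i < n"
    have pair: "norm (T (y i), M * (a i - f i (T (y i)))) < 1 + \<eta>"
      using T(2)[OF i] i by (simp add: A_def)
    show "norm (T (y i)) < 1 + \<eta>"
      by (rule le_less_trans[OF norm_fst_le pair])
    have "norm (M * (a i - f i (T (y i)))) < 1 + \<eta>"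
      by (rule le_less_trans[OF norm_snd_le pair])
    then have "\<bar>a i - f i (T (y i))\<bar> < (1 + \<eta>) / M" using M(1) by (simp add: abs_mult pos_less_divide_eq mult.commute)
    then show "\<bar>blinfun_apply (\<phi> (f i)) (y i) - f i (T (y i))\<bar> < \<eta>" by (simp add: M a_def)
  qed
qed

end

lemma nearly_norming_functional:
  assumes "one_norming N" "0 < \<delta>" "g0 \<in> N" "norm g0 \<le> 1"
  obtains g where "g \<in> N" "norm g \<le> 1" "norm y - \<delta> < \<bar>blinfun_apply g y\<bar>"
proof -
  have "norm y - \<delta> < Sup {\<bar>blinfun_apply g y\<bar> |g. g \<in> N \<and> norm g \<le> 1}"
    using spec[OF assms(1)[unfolded one_norming_def], of y] assms(2) by simp
  then show ?thesis using assms(3,4) that by (elim less_cSupE) auto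
qed

section \<open>Strict ideals are almost isometric ideals\<close>

theorem proposition2p1:
  fixes X :: "'a::banach set"
  assumes "subspace X"
    and "strict_ideal X"
  shows "ai_ideal X"
proof -
  obtain \<phi> where \<phi>: "hahn_banach_extension_operator X \<phi>" "one_norming (\<phi> ` dual_space X)"
    using assms(2) by (auto simp: strict_ideal_def)
  interpret extension_operator X \<phi> using assms(1) \<phi>(1) by unfold_locales
  show ?thesis unfolding ai_ideal_def
  proof (intro allI impI, elim conjE exE)
    fix \<epsilon> :: real and E F :: "'a set"
    assume \<epsilon>: "\<epsilon> > 0" and E: "subspace E" "finite F" "E = span F"
    define \<delta> where "\<delta> = \<epsilon> / (4 * (1 + \<epsilon>))"
    (* This makes 1 - 4 \<delta> equal to the required lower bound; the upper bound then has room to spare. *)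
    have \<delta>: "0 < \<delta>" "\<delta> \<le> 1 / 3" "3 * \<delta> \<le> \<epsilon>" "1 - 4 * \<delta> = inverse (1 + \<epsilon>)"
      using \<epsilon> by (auto simp: \<delta>_def field_simps)
    obtain B where B: "B \<subseteq> E" "independent B" "E \<subseteq> span B"
      using maximal_independent_subset[of E] by blast
    have finB: "finite B" using independent_span_bound[OF E(2) B(2)] B(1) E(3) by blast
    have EB: "E = span B" using B span_minimal[OF B(1) E(1)] by blast
    obtain N where N: "finite N" "N \<subseteq> {e \<in> E. norm e = 1}" "{e \<in> E. norm e = 1} \<subseteq> (\<Union>y\<in>N. ball y \<delta>)"
      using seq_compact_imp_totally_bounded[OF compact_imp_seq_compact[OF compact_sphere_span[OF finB B(2)]]] \<delta>(1)
      unfolding EB by meson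
    obtain y and n :: nat where y: "N = y ` {i. i < n}"
      using finite_imp_nat_seg_image_inj_on[OF N(1)] by metis
    have yN: "y i \<in> E" "norm (y i) = 1" if "i < n" for i
      using N(2) that unfolding y by auto
    have "\<exists>f\<in>dual_space X. norm (\<phi> f) \<le> 1 \<and> 1 - \<delta> < \<bar>blinfun_apply (\<phi> f) (y i)\<bar>" if "i < n" for i
    proof -
      have "0 \<in> \<phi> ` dual_space X" using zero_in_dual_space extension_zero by (metis imageI)
      then obtain g where "g \<in> \<phi> ` dual_space X" "norm g \<le> 1" "norm (y i) - \<delta> < \<bar>blinfun_apply g (y i)\<bar>"
        using nearly_norming_functional[OF \<phi>(2) \<delta>(1)] by (metis norm_zero zero_le_one)
      with yN[OF that] show ?thesis by auto
    qed
    then obtain f where f: "\<And>i. i < n \<Longrightarrow> f i \<in> dual_space X" "\<And>i. i < n \<Longrightarrow> norm (\<phi> (f i)) \<le> 1"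
      "\<And>i. i < n \<Longrightarrow> 1 - \<delta> < \<bar>blinfun_apply (\<phi> (f i)) (y i)\<bar>"
      by metis
    obtain T where T: "T \<in> local_projections E" "\<And>i. i < n \<Longrightarrow> norm (T (y i)) < 1 + \<delta>"
      "\<And>i. i < n \<Longrightarrow> \<bar>blinfun_apply (\<phi> (f i)) (y i) - f i (T (y i))\<bar> < \<delta>"
      using approximate_local_reflexivity[of E F n y f \<delta>, OF E yN(1) eq_refl[OF yN(2)] f(1) \<delta>(1)] by blast
    have lin: "linear T" and TX: "\<And>e. e \<in> E \<Longrightarrow> T e \<in> X" and Tid: "\<And>e. e \<in> X \<inter> E \<Longrightarrow> T e = e"
      using T(1) by (auto simp: local_projections_def)
    have low_y: "1 - 2 * \<delta> \<le> norm (T (y i))" if i: "i < n" for i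
    proof -
      have "\<bar>f i (T (y i))\<bar> = \<bar>blinfun_apply (\<phi> (f i)) (T (y i))\<bar>"
        using extends[OF f(1)[OF i] TX[OF yN(1)[OF i]]] by simp
      also have "\<dots> \<le> norm (\<phi> (f i)) * norm (T (y i))"
        using norm_blinfun[of "\<phi> (f i)" "T (y i)"] by simp
      also have "\<dots> \<le> norm (T (y i))" using f(2)[OF i] by (simp add: mult_left_le_one_le)
      finally show ?thesis using f(3)[OF i] T(3)[OF i] by linarith
    qed
    have up: "norm (T u) \<le> 1 + \<delta>" and low: "1 - 2 * \<delta> \<le> norm (T u)" if "u \<in> N" for u
      using that T(2) low_y unfolding y by (auto intro: less_imp_le)
    have "N \<subseteq> span B" and "{e \<in> span B. norm e = 1} \<subseteq> (\<Union>y\<in>N. ball y \<delta>)"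
      using N(2,3) unfolding EB by auto
    then have iso: "(1 - 4 * \<delta>) * norm e \<le> norm (T e)" "norm (T e) \<le> (1 + 3 * \<delta>) * norm e" if "e \<in> E" for e
      using almost_isometric_on_net[of B T \<delta> N e] finB B(2) lin \<delta>(1,2) up low that by (simp_all add: EB)
    have "inverse (1 + \<epsilon>) * norm e \<le> norm (T e) \<and> norm (T e) \<le> (1 + \<epsilon>) * norm e" if "e \<in> E" for e
    proof
      show "inverse (1 + \<epsilon>) * norm e \<le> norm (T e)" using iso(1)[OF that] by (simp add: \<delta>(4))
      have "(1 + 3 * \<delta>) * norm e \<le> (1 + \<epsilon>) * norm e" using \<delta>(3) by (intro mult_right_mono) auto
      then show "norm (T e) \<le> (1 + \<epsilon>) * norm e" using iso(2)[OF that] by linarith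
    qed
    moreover have "linear_on E T" using lin by (simp add: linear_on_def linear_add linear_cmul)
    ultimately show "\<exists>T. linear_on E T \<and> T ` E \<subseteq> X \<and> (\<forall>e\<in>X \<inter> E. T e = e) \<and>
        (\<forall>e\<in>E. inverse (1 + \<epsilon>) * norm e \<le> norm (T e) \<and> norm (T e) \<le> (1 + \<epsilon>) * norm e)"
      using TX Tid by (intro exI[of _ T]) auto
  qed
qed

end
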